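(* There is no boundedly generated infinite branch group. That is, if $G$ is an infinite branch group, then $G$ is not boundedly generated.
   Context: A group $G$ is boundedly generated if it contains a finite subset $\{g_1,\ldots,g_n\}$ such that every $g\in G$ can be written as $g=g_1^{k_1}\cdots g_n^{k_n}$ for appropriate $k_1,\ldots,k_n\in\mathbb{Z}$ (the elements $g_1,\dots,g_n$ are taken in a fixed order). A group $G$ is called a branch group if it admits a decreasing sequence of subgroups $(H_i)_{i\in\mathbb{N}_0}$ with $H_0=G$ and $\bigcap_{i\in\mathbb{N}_0}H_i=1$, and a sequence of integers $(k_i)_{i\in\mathbb{N}_0}$ with $k_0=1$, such that for each $i$ the following hold: (1) $H_i$ is a normal subgroup of finite index in $G$. (2) $H_i$ splits as a direct product $H_i=H_i^{(1)}\times\cdots\times H_i^{(k_i)}$ (an internal direct product of subgroups), where the factors are pairwise isomorphic. (3) The quotient $m_{i+1}:=k_{i+1}/k_i$ is an integer with $m_{i+1}\ge 2$, and the product decomposition of $H_{i+1}$ refines that of $H_i$ in the sense that each factor $H_i^{(j)}$ of $H_i$ contains the factors $H_{i+1}^{(\ell)}$ of $H_{i+1}$ for all $\ell$ with $(j-1)\cdot m_{i+1}+1\le \ell\le j\cdot m_{i+1}$. (4) $G$ acts transitively by conjugation on the set of factors $H_i^{(j)}$ of $H_i$. *)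

theory Defs
  imports "HOL-Algebra.Algebra"
begin

(* The list records the fixed order of the generators; repetitions are allowed, so this is the
   condition that G is a product of finitely many cyclic subgroups. *)
definition boundedly_generated :: "('a, 'b) monoid_scheme \<Rightarrow> bool"
  where "boundedly_generated G \<longleftrightarrow>
    (\<exists>gs. set gs \<subseteq> carrier G \<and>
      (\<forall>g\<in>carrier G. \<exists>ks::int list. length ks = length gs \<and>
         g = foldr (\<otimes>\<^bsub>G\<^esub>) (map2 (\<lambda>x k. x [^]\<^bsub>G\<^esub> k) gs ks) \<one>\<^bsub>G\<^esub>))"

(* The subgroup H of G is the internal direct product of the family (K j), j in I; the indexed
   form matters, since a nontrivial factor may not occur twice. *)
definition internal_direct_product ::
    "('a, 'b) monoid_scheme \<Rightarrow> 'a set \<Rightarrow> 'i set \<Rightarrow> ('i \<Rightarrow> 'a set) \<Rightarrow> bool"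
  where "internal_direct_product G H I K \<longleftrightarrow>
    subgroup H G \<and>
    (\<forall>j\<in>I. K j \<lhd> G\<lparr>carrier := H\<rparr>) \<and>
    generate G (\<Union>j\<in>I. K j) = H \<and>
    (\<forall>j\<in>I. K j \<inter> generate G (\<Union>l\<in>I - {j}. K l) = {\<one>\<^bsub>G\<^esub>})"

(* F i j is the j-th factor of H i. The conjugation action of the last clause being a
   group action on the set of factors includes that conjugation permutes the factors. *)
definition branch_structure ::
    "('a, 'b) monoid_scheme \<Rightarrow> (nat \<Rightarrow> 'a set) \<Rightarrow> (nat \<Rightarrow> nat) \<Rightarrow> (nat \<Rightarrow> nat \<Rightarrow> 'a set) \<Rightarrow> bool"
  where "branch_structure G H k F \<longleftrightarrow>
    H 0 = carrier G \<and> (\<forall>i. H (Suc i) \<subseteq> H i) \<and> (\<Inter>i. H i) = {\<one>\<^bsub>G\<^esub>} \<and> k 0 = 1 \<and>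
    (\<forall>i. H i \<lhd> G \<and> finite (rcosets\<^bsub>G\<^esub> (H i))) \<and>
    (\<forall>i. internal_direct_product G (H i) {1..k i} (F i) \<and>
         (\<forall>j\<in>{1..k i}. \<forall>l\<in>{1..k i}. G\<lparr>carrier := F i j\<rparr> \<cong> G\<lparr>carrier := F i l\<rparr>)) \<and>
    (\<forall>i. k i dvd k (Suc i) \<and>
         (let m = k (Suc i) div k i in
            2 \<le> m \<and>
            (\<forall>j\<in>{1..k i}. \<forall>l\<in>{(j - 1) * m + 1..j * m}. F (Suc i) l \<subseteq> F i j))) \<and>
    (\<forall>i. transitive_action G (F i ` {1..k i})
           (\<lambda>g. \<lambda>K\<in>F i ` {1..k i}. g <#\<^bsub>G\<^esub> K #>\<^bsub>G\<^esub> (inv\<^bsub>G\<^esub> g)))"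

definition branch_group :: "('a, 'b) monoid_scheme \<Rightarrow> bool"
  where "branch_group G \<longleftrightarrow> group G \<and> (\<exists>H k F. branch_structure G H k F)"

end

theory Submission
  imports Defs
begin

text \<open>
  The proof compares the order of a finite quotient of \<open>G\<close> with its exponent. If \<open>G\<close> is a product
  of \<open>n\<close> cyclic subgroups, then so is each quotient, and a quotient of exponent dividing \<open>e\<close> has at
  most \<open>e ^ n\<close> elements (\<open>rcosets_bounded_generation\<close>). A direct power of a finite group of order
  \<open>q\<close> violates this kind of bound: with \<open>k\<close> factors its order is \<open>q ^ k\<close>, while its exponent
  still divides \<open>q\<close>.

  In a branch group the number of factors of \<open>H i\<close> is at least \<open>2 ^ i\<close>, so some \<open>H = H n\<close>,
  of finite index \<open>D\<close>, has \<open>k > n\<close> factors \<open>F j\<close>. Let \<open>N\<close> be any normal subgroup of finite index in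
  \<open>G\<close>. Since \<open>G\<close> permutes the factors transitively by conjugation, the images of all \<open>F j\<close> in \<open>G/N\<close>
  have the same order \<open>q\<close>, and the product \<open>M\<close> of the groups \<open>F j \<inter> N\<close> is normal in \<open>G\<close>. Now \<open>H/M\<close>
  is a direct product of \<open>k\<close> groups of order \<open>q\<close>, so \<open>G/M\<close> has exponent dividing \<open>D * q\<close> and at
  least \<open>q ^ k\<close> elements. Bounded generation gives \<open>q ^ k \<le> (D * q) ^ n\<close>, hence \<open>q \<le> D ^ n\<close>
  because \<open>k > n\<close> (\<open>card_image_factor_le\<close>).

  This bound does not depend on \<open>N\<close>. Taking for \<open>N\<close> the groups \<open>H m\<close>, which decrease to the trivial
  group, shows that each factor is finite (\<open>finite_if_bounded_images\<close>); then \<open>H\<close> is finite, and so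
  is \<open>G\<close>.
\<close>

section \<open>Bounded generation and exponents\<close>

abbreviation prod_of_powers :: "('a, 'b) monoid_scheme \<Rightarrow> 'a list \<Rightarrow> int list \<Rightarrow> 'a"
  where "prod_of_powers G gs ks \<equiv>
    foldr (\<otimes>\<^bsub>G\<^esub>) (map2 (\<lambda>x k. x [^]\<^bsub>G\<^esub> k) gs ks) \<one>\<^bsub>G\<^esub>"

context group
begin

lemma prod_of_powers_closed:
  "set gs \<subseteq> carrier G \<Longrightarrow> prod_of_powers G gs ks \<in> carrier G"
proof (induction gs arbitrary: ks)
  case (Cons g gs)
  then show ?case by (cases ks) auto
qed simp

lemma int_pow_mod_exponent:
  fixes k :: int
  assumes "x \<in> carrier G" "x [^] (e::nat) = \<one>"
  shows "x [^] (k mod int e) = x [^] k"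
proof -
  have "x [^] k = x [^] (int e * (k div int e) + k mod int e)"
    by simp
  also have "\<dots> = (x [^] int e) [^] (k div int e) \<otimes> x [^] (k mod int e)"
    using assms(1) by (simp only: int_pow_mult int_pow_pow)
  also have "\<dots> = x [^] (k mod int e)"
    using assms by (simp add: int_pow_int)
  finally show ?thesis ..
qed

lemma prod_of_powers_mod_exponent:
  assumes "set gs \<subseteq> carrier G" and "\<And>x. x \<in> carrier G \<Longrightarrow> x [^] (e::nat) = \<one>"
    and "length ks = length gs"
  shows "prod_of_powers G gs (map (\<lambda>k. k mod int e) ks) = prod_of_powers G gs ks"
  using assms(3,1)
  by (induction ks gs rule: list_induct2) (auto simp: int_pow_mod_exponent assms(2))

text \<open>
  All exponents can be reduced modulo \<open>e\<close>, so there are at most \<open>e\<close> choices for each of them.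
\<close>
lemma card_bounded_generation_exponent:
  assumes gs: "set gs \<subseteq> carrier G"
    and gen: "\<And>g. g \<in> carrier G \<Longrightarrow> \<exists>ks. length ks = length gs \<and> g = prod_of_powers G gs ks"
    and "0 < (e::nat)" and expo: "\<And>x. x \<in> carrier G \<Longrightarrow> x [^] e = \<one>"
  shows "finite (carrier G)" and "card (carrier G) \<le> e ^ length gs"
proof -
  let ?R = "{ks. set ks \<subseteq> {0..<int e} \<and> length ks = length gs}"
  have sub: "carrier G \<subseteq> prod_of_powers G gs ` ?R"
  proof
    fix g assume "g \<in> carrier G"
    then obtain ks where ks: "length ks = length gs" "g = prod_of_powers G gs ks"
      using gen by blast
    have "map (\<lambda>k. k mod int e) ks \<in> ?R"
      using ks \<open>0 < e\<close> by auto
    then show "g \<in> prod_of_powers G gs ` ?R"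
      using prod_of_powers_mod_exponent[OF gs expo ks(1)] ks(2) by (metis (no_types, lifting) image_eqI)
  qed
  have fin: "finite ?R" by (rule finite_lists_length_eq) simp
  have card: "card ?R = e ^ length gs"
    by (subst card_lists_length_eq) auto
  show "finite (carrier G)" using sub fin finite_surj by blast
  show "card (carrier G) \<le> e ^ length gs"
    using surj_card_le[OF fin sub] card by simp
qed

end

lemma (in group_hom) hom_prod_of_powers:
  assumes "set gs \<subseteq> carrier G"
  shows "h (prod_of_powers G gs ks) = prod_of_powers H (map h gs) ks"
  using assms
proof (induction gs arbitrary: ks)
  case (Cons g gs)
  then show ?case
    by (cases ks) (auto simp: G.prod_of_powers_closed hom_int_pow)
qed simp

section \<open>Finite quotients\<close>

context normal
begin

lemma group_hom_Mod: "group_hom G (G Mod H) ((#>) H)"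
  by (intro group_hom.intro group_hom_axioms.intro is_group factorgroup_is_group r_coset_hom_Mod)

lemma rcos_eq_iff:
  assumes "x \<in> carrier G" "y \<in> carrier G"
  shows "H #> x = H #> y \<longleftrightarrow> inv x \<otimes> y \<in> H"
proof -
  have "H #> x = H #> y \<longleftrightarrow> y \<otimes> inv x \<in> H"
    using assms by (metis is_group rcos_module rcos_self repr_independence subgroup_axioms)
  also have "y \<otimes> inv x \<in> H \<longleftrightarrow> inv x \<otimes> y \<in> H"
  proof
    assume "y \<otimes> inv x \<in> H"
    then have "inv x \<otimes> (y \<otimes> inv x) \<otimes> x \<in> H" using assms(1) by (rule inv_op_closed1[rotated])
    then show "inv x \<otimes> y \<in> H" using assms by (simp add: m_assoc)
  next
    assume "inv x \<otimes> y \<in> H"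
    then have "x \<otimes> (inv x \<otimes> y) \<otimes> inv x \<in> H" using assms(1) by (rule inv_op_closed2[rotated])
    then show "y \<otimes> inv x \<in> H" using assms by (simp add: m_assoc[symmetric])
  qed
  finally show ?thesis .
qed

text \<open>
  The images of \<open>gs\<close> boundedly generate the quotient, which has exponent dividing \<open>e\<close>.
\<close>
lemma rcosets_bounded_generation:
  assumes gs: "set gs \<subseteq> carrier G"
    and gen: "\<And>g. g \<in> carrier G \<Longrightarrow> \<exists>ks. length ks = length gs \<and> g = prod_of_powers G gs ks"
    and "0 < (e::nat)" and expo: "\<And>x. x \<in> carrier G \<Longrightarrow> x [^] e \<in> H"
  shows "finite (rcosets H)" and "card (rcosets H) \<le> e ^ length gs"
proof -
  interpret Q: group "G Mod H" by (rule factorgroup_is_group)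
  interpret pr: group_hom G "G Mod H" "(#>) H" by (rule group_hom_Mod)
  have surj: "\<exists>x\<in>carrier G. Y = H #> x" if "Y \<in> carrier (G Mod H)" for Y
    using that by (auto simp: carrier_FactGroup)
  have 1: "set (map ((#>) H) gs) \<subseteq> carrier (G Mod H)"
    using gs by (auto simp: carrier_FactGroup)
  have 2: "\<exists>ks. length ks = length (map ((#>) H) gs) \<and>
      Y = prod_of_powers (G Mod H) (map ((#>) H) gs) ks" if Y: "Y \<in> carrier (G Mod H)" for Y
    using surj[OF Y] gen pr.hom_prod_of_powers[OF gs] by (metis length_map)
  have 3: "Y [^]\<^bsub>G Mod H\<^esub> e = \<one>\<^bsub>G Mod H\<^esub>" if Y: "Y \<in> carrier (G Mod H)" for Y
    using surj[OF Y] expo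
    by (auto simp: FactGroup_pow one_FactGroup coset_join2 subgroup_axioms)
  show "finite (rcosets H)" "card (rcosets H) \<le> e ^ length gs"
    using Q.card_bounded_generation_exponent[OF 1 2 \<open>0 < e\<close> 3]
    by (simp_all add: FactGroup_def)
qed

text \<open>
  This is Lagrange's theorem in the image of \<open>K\<close> in the quotient. For \<open>K = carrier G\<close> the exponent is
  the index of \<open>H\<close>.
\<close>
lemma subgroup_pow_card_image:
  assumes "subgroup K G" "x \<in> K"
  shows "x [^] card ((#>) H ` K) \<in> H"
proof -
  interpret Q: group "G Mod H" by (rule factorgroup_is_group)
  interpret pr: group_hom G "G Mod H" "(#>) H" by (rule group_hom_Mod)
  have sub: "subgroup ((#>) H ` K) (G Mod H)"
    by (rule pr.subgroup_img_is_subgroup[OF assms(1)])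
  interpret I: group "(G Mod H)\<lparr>carrier := (#>) H ` K\<rparr>"
    by (rule Q.subgroup_imp_group[OF sub])
  have x: "x \<in> carrier G" using assms subgroup.mem_carrier by metis
  have "(H #> x) [^]\<^bsub>(G Mod H)\<lparr>carrier := (#>) H ` K\<rparr>\<^esub> card ((#>) H ` K) = \<one>\<^bsub>G Mod H\<^esub>"
    using I.pow_order_eq_1[of "H #> x"] assms(2) by (simp add: order_def)
  then have "(H #> x) [^]\<^bsub>G Mod H\<^esub> card ((#>) H ` K) = H"
    by (simp add: nat_pow_consistent[symmetric] Q.nat_pow_consistent[symmetric])
  then have "H #> (x [^] card ((#>) H ` K)) = H"
    using x by (simp add: FactGroup_pow)
  then show ?thesis
    using coset_join1[OF _ nat_pow_closed[OF x] subgroup_axioms] by simp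
qed

text \<open>
  The two images are conjugate in the quotient by the class of \<open>g\<close>.
\<close>
lemma card_image_conjugate:
  assumes g: "g \<in> carrier G" and K: "K \<subseteq> carrier G"
  shows "card ((#>) H ` (g <# K #> inv g)) = card ((#>) H ` K)"
proof -
  interpret Q: group "G Mod H" by (rule factorgroup_is_group)
  interpret pr: group_hom G "G Mod H" "(#>) H" by (rule group_hom_Mod)
  let ?c = "\<lambda>Y. (H #> g) \<otimes>\<^bsub>G Mod H\<^esub> Y \<otimes>\<^bsub>G Mod H\<^esub> (H #> inv g)"
  have "g <# K #> inv g = (\<lambda>x. g \<otimes> x \<otimes> inv g) ` K"
    by (auto simp: l_coset_def r_coset_def)
  then have "(#>) H ` (g <# K #> inv g) = (\<lambda>x. H #> (g \<otimes> x \<otimes> inv g)) ` K"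
    by (simp add: image_image)
  also have "\<dots> = (\<lambda>x. ?c (H #> x)) ` K"
    using g K by (intro image_cong refl) (auto simp: pr.hom_mult subsetD)
  finally have eq: "(#>) H ` (g <# K #> inv g) = ?c ` ((#>) H ` K)"
    by (simp add: image_image)
  have "inj_on ?c (carrier (G Mod H))"
    using pr.hom_closed[OF g] pr.hom_closed[OF inv_closed[OF g]] by (intro inj_onI) (simp del: mult_FactGroup)
  moreover have "(#>) H ` K \<subseteq> carrier (G Mod H)"
    using K by (auto simp: carrier_FactGroup)
  ultimately show ?thesis
    unfolding eq by (metis card_image inj_on_subset)
qed

end

section \<open>Families of independent commuting subgroups\<close>

text \<open>
  An internal direct product, described without naming the product as an ambient group. In this form
  the conditions are inherited by any family of subgroups of the factors, which yields the direct
  product of the groups \<open>F j \<inter> N\<close> from that of the \<open>F j\<close>.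
\<close>
locale direct_factors = group +
  fixes I :: "'i set" and F :: "'i \<Rightarrow> 'a set"
  assumes finite_index: "finite I"
    and factor_subgroup: "j \<in> I \<Longrightarrow> subgroup (F j) G"
    and factors_commute:
      "\<lbrakk>j \<in> I; l \<in> I; j \<noteq> l; x \<in> F j; y \<in> F l\<rbrakk> \<Longrightarrow> x \<otimes> y = y \<otimes> x"
    and factors_independent: "j \<in> I \<Longrightarrow> F j \<inter> generate G (\<Union>l\<in>I - {j}. F l) = {\<one>}"
begin

lemma factor_carrier: "\<lbrakk>j \<in> I; x \<in> F j\<rbrakk> \<Longrightarrow> x \<in> carrier G"
  using factor_subgroup subgroup.mem_carrier by metis

lemma Union_factors_carrier: "J \<subseteq> I \<Longrightarrow> (\<Union>j\<in>J. F j) \<subseteq> carrier G"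
  using factor_carrier by blast

lemma generate_factors_subgroup: "J \<subseteq> I \<Longrightarrow> subgroup (generate G (\<Union>j\<in>J. F j)) G"
  by (intro generate_is_subgroup Union_factors_carrier)

lemma generate_factors_carrier:
  "\<lbrakk>J \<subseteq> I; y \<in> generate G (\<Union>j\<in>J. F j)\<rbrakk> \<Longrightarrow> y \<in> carrier G"
  by (rule generate_in_carrier[OF Union_factors_carrier])

lemma factor_commutes_generate:
  assumes "J \<subseteq> I" "l \<in> I" "l \<notin> J" "x \<in> F l" "y \<in> generate G (\<Union>j\<in>J. F j)"
  shows "x \<otimes> y = y \<otimes> x"
  using assms(5)
proof (induction y rule: generate.induct)
  have x: "x \<in> carrier G" using assms factor_carrier by blast
  {
    case one show ?case using x by simp
  next
    case (incl h) then show ?case using assms factors_commute by blast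
  next
    case (inv h)
    then have "h \<in> carrier G" "x \<otimes> h = h \<otimes> x"
      using assms factors_commute factor_carrier by blast+
    then show ?case using x by (metis inv_closed inv_solve_left inv_solve_right m_assoc m_closed)
  next
    case (eng h1 h2)
    then have "h1 \<in> carrier G" "h2 \<in> carrier G"
      using generate_factors_carrier[OF assms(1)] by auto
    then show ?case using eng x by (metis m_assoc)
  }
qed

lemma generate_factors_insertE:
  assumes "J \<subseteq> I" "l \<in> I" "l \<notin> J" "x \<in> generate G (\<Union>j\<in>insert l J. F j)"
  obtains a b where "a \<in> F l" "b \<in> generate G (\<Union>j\<in>J. F j)" "x = a \<otimes> b"
proof -
  let ?S = "generate G (\<Union>j\<in>J. F j)"
  interpret S: subgroup ?S G by (rule generate_factors_subgroup[OF assms(1)])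
  interpret A: subgroup "F l" G by (rule factor_subgroup[OF assms(2)])
  note comm = factor_commutes_generate[OF assms(1-3)]
  have "\<exists>a\<in>F l. \<exists>b\<in>?S. x = a \<otimes> b"
    using assms(4)
  proof (induction x rule: generate.induct)
    case one
    show ?case by (intro bexI[of _ \<one>]) auto
  next
    case (incl h)
    then consider "h \<in> F l" | "h \<in> ?S" by (auto intro: generate.incl)
    then show ?case
    proof cases
      case 1 then show ?thesis by (intro bexI[of _ h] bexI[of _ \<one>]) auto
    next
      case 2 then show ?thesis by (intro bexI[of _ \<one>] bexI[of _ h]) auto
    qed
  next
    case (inv h)
    then consider "h \<in> F l" | "h \<in> ?S" by (auto intro: generate.incl)
    then show ?case
    proof cases
      case 1 then show ?thesis by (intro bexI[of _ "inv h"] bexI[of _ \<one>]) auto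
    next
      case 2 then show ?thesis by (intro bexI[of _ \<one>] bexI[of _ "inv h"]) auto
    qed
  next
    case (eng h1 h2)
    then obtain a1 b1 a2 b2 where
      ab: "a1 \<in> F l" "b1 \<in> ?S" "a2 \<in> F l" "b2 \<in> ?S" "h1 = a1 \<otimes> b1" "h2 = a2 \<otimes> b2"
      by blast
    then have "h1 \<otimes> h2 = a1 \<otimes> (b1 \<otimes> a2) \<otimes> b2"
      by (simp add: m_assoc)
    also have "b1 \<otimes> a2 = a2 \<otimes> b1" using comm[OF ab(3,2)] by simp
    finally have "h1 \<otimes> h2 = (a1 \<otimes> a2) \<otimes> (b1 \<otimes> b2)"
      using ab by (simp add: m_assoc)
    then show ?case using ab by (meson A.m_closed S.m_closed)
  qed
  then show thesis using that by blast
qed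

lemma finite_generate_factors:
  assumes "\<And>j. j \<in> I \<Longrightarrow> finite (F j)"
  shows "finite (generate G (\<Union>j\<in>I. F j))"
proof -
  have "finite (generate G (\<Union>j\<in>J. F j))" if "J \<subseteq> I" for J
    using finite_subset[OF that finite_index] that
  proof (induction J rule: finite_induct)
    case empty
    then show ?case by (simp add: generate_empty)
  next
    case (insert l J)
    let ?S = "generate G (\<Union>j\<in>J. F j)"
    have "generate G (\<Union>j\<in>insert l J. F j) \<subseteq> (\<lambda>(a, b). a \<otimes> b) ` (F l \<times> ?S)"
    proof
      fix x assume "x \<in> generate G (\<Union>j\<in>insert l J. F j)"
      then obtain a b where "a \<in> F l" "b \<in> ?S" "x = a \<otimes> b"
        using insert.prems insert.hyps generate_factors_insertE[of J l x] by blast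
      then show "x \<in> (\<lambda>(a, b). a \<otimes> b) ` (F l \<times> ?S)" by force
    qed
    moreover have "finite (F l \<times> ?S)" using insert assms by auto
    ultimately show ?case by (rule finite_surj[rotated])
  qed
  then show ?thesis by blast
qed

lemma subfactors:
  assumes "\<And>j. j \<in> I \<Longrightarrow> subgroup (E j) G" "\<And>j. j \<in> I \<Longrightarrow> E j \<subseteq> F j"
  shows "direct_factors G I E"
proof (intro direct_factors.intro direct_factors_axioms.intro is_group)
  show "E j \<inter> generate G (\<Union>l\<in>I - {j}. E l) = {\<one>}" if j: "j \<in> I" for j
  proof -
    have "generate G (\<Union>l\<in>I - {j}. E l) \<subseteq> generate G (\<Union>l\<in>I - {j}. F l)"
      using assms(2) by (intro mono_generate) blast
    then have "E j \<inter> generate G (\<Union>l\<in>I - {j}. E l) \<subseteq> {\<one>}"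
      using factors_independent[OF j] assms(2)[OF j] by blast
    then show ?thesis
      using subgroup.one_closed[OF assms(1)[OF j]] generate.one[of G] by blast
  qed
  show "x \<otimes> y = y \<otimes> x" if "j \<in> I" "l \<in> I" "j \<noteq> l" "x \<in> E j" "y \<in> E l" for j l x y
    using that assms(2) factors_commute by blast
qed (use assms finite_index in auto)

text \<open>
  Powers in a direct product are taken componentwise; if \<open>q\<close> kills each \<open>F j / E j\<close>, it therefore
  kills the quotient of the products.
\<close>
lemma generate_factors_pow:
  assumes "direct_factors G I E"
    and pow: "\<And>j x. \<lbrakk>j \<in> I; x \<in> F j\<rbrakk> \<Longrightarrow> x [^] (q::nat) \<in> E j"
    and x: "x \<in> generate G (\<Union>j\<in>I. F j)"
  shows "x [^] q \<in> generate G (\<Union>j\<in>I. E j)"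
proof -
  interpret E: direct_factors G I E by (rule assms(1))
  interpret M: subgroup "generate G (\<Union>j\<in>I. E j)" G
    by (rule E.generate_factors_subgroup) simp
  have "x [^] q \<in> generate G (\<Union>j\<in>I. E j)"
    if "J \<subseteq> I" "x \<in> generate G (\<Union>j\<in>J. F j)" for J x
    using finite_subset[OF that(1) finite_index] that
  proof (induction J arbitrary: x rule: finite_induct)
    case empty
    then show ?case by (simp add: generate_empty)
  next
    case (insert l J)
    then have l: "J \<subseteq> I" "l \<in> I" "l \<notin> J" by auto
    obtain a b where ab: "a \<in> F l" "b \<in> generate G (\<Union>j\<in>J. F j)" "x = a \<otimes> b"
      using generate_factors_insertE[OF l insert.prems(2)] by blast
    have "a \<in> carrier G" "b \<in> carrier G"
      using ab l factor_carrier generate_factors_carrier by blast+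
    then have "x [^] q = a [^] q \<otimes> b [^] q"
      using pow_mult_distrib factor_commutes_generate[OF l ab(1,2)] ab(3) by blast
    moreover have "a [^] q \<in> generate G (\<Union>j\<in>I. E j)"
      using pow[OF l(2) ab(1)] l by (auto intro: generate.incl)
    moreover have "b [^] q \<in> generate G (\<Union>j\<in>I. E j)"
      using insert.IH[OF l(1) ab(2)] .
    ultimately show ?case by simp
  qed
  then show ?thesis using x by blast
qed

text \<open>
  The decomposition of \<open>a \<otimes> b\<close> along \<open>F l\<close> and the remaining factors is unique, and an element of
  the product of the \<open>E j\<close> already has such a decomposition with components in the \<open>E j\<close>.
\<close>
lemma component_in_subfactor:
  assumes "direct_factors G I E" and EF: "\<And>j. j \<in> I \<Longrightarrow> E j \<subseteq> F j"
    and l: "l \<in> I" and J: "J \<subseteq> I" "l \<notin> J"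
    and a: "a \<in> F l" and b: "b \<in> generate G (\<Union>j\<in>J. F j)"
    and ab: "a \<otimes> b \<in> generate G (\<Union>j\<in>I. E j)"
  shows "a \<in> E l"
proof -
  interpret E: direct_factors G I E by (rule assms(1))
  let ?S = "generate G (\<Union>j\<in>I - {l}. F j)"
  interpret S: subgroup ?S G by (rule generate_factors_subgroup) simp
  interpret A: subgroup "F l" G by (rule factor_subgroup[OF l])
  have "insert l (I - {l}) = I" using l by blast
  then obtain a' b' where ab': "a' \<in> E l" "b' \<in> generate G (\<Union>j\<in>I - {l}. E j)"
      "a \<otimes> b = a' \<otimes> b'"
    using E.generate_factors_insertE[of "I - {l}" l "a \<otimes> b"] l ab by auto
  have b'S: "b' \<in> ?S"
    using ab'(2) EF mono_generate[of "\<Union>j\<in>I - {l}. E j" "\<Union>j\<in>I - {l}. F j"] by blast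
  have bS: "b \<in> ?S"
    using b J mono_generate[of "\<Union>j\<in>J. F j" "\<Union>j\<in>I - {l}. F j"] by blast
  have a': "a' \<in> F l" using ab' EF l by blast
  have "inv a' \<otimes> a = b' \<otimes> inv b"
    using ab'(3) a a' bS b'S inv_solve_right[of "inv a' \<otimes> a" b' b] inv_solve_left[of b' a' "a \<otimes> b"]
    by (simp add: m_assoc)
  moreover have "inv a' \<otimes> a \<in> F l" using a a' by simp
  moreover have "b' \<otimes> inv b \<in> ?S" using bS b'S by simp
  ultimately have "inv a' \<otimes> a = \<one>" using factors_independent[OF l] by auto
  then have "a = a'" using a a' inv_solve_left[of \<one> a' a] by simp
  then show ?thesis using ab' by simp
qed

text \<open>
  With \<open>R j\<close> a set of representatives of cosets of \<open>E j\<close> in \<open>F j\<close>, the products of one representative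
  from each factor lie in different cosets of the product of the \<open>E j\<close>. The set \<open>T\<close> of these
  products is built one factor at a time.
\<close>
lemma card_cosets_generate_factors:
  assumes E: "direct_factors G I E" and EF: "\<And>j. j \<in> I \<Longrightarrow> E j \<subseteq> F j"
    and M: "generate G (\<Union>j\<in>I. E j) \<lhd> G"
    and RF: "\<And>j. j \<in> I \<Longrightarrow> R j \<subseteq> F j" and Rcard: "\<And>j. j \<in> I \<Longrightarrow> card (R j) = q"
    and Rsep: "\<And>j x y. \<lbrakk>j \<in> I; x \<in> R j; y \<in> R j; inv x \<otimes> y \<in> E j\<rbrakk> \<Longrightarrow> x = y"
    and fin: "finite (rcosets (generate G (\<Union>j\<in>I. E j)))"
  shows "q ^ card I \<le> card (rcosets (generate G (\<Union>j\<in>I. E j)))"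
proof -
  let ?M = "generate G (\<Union>j\<in>I. E j)"
  interpret E: direct_factors G I E by (rule E)
  interpret M: normal ?M G by (rule M)
  have "\<exists>T. T \<subseteq> generate G (\<Union>j\<in>J. F j) \<and> card T = q ^ card J \<and>
      (\<forall>x\<in>T. \<forall>y\<in>T. inv x \<otimes> y \<in> ?M \<longrightarrow> x = y)" if "J \<subseteq> I" for J
    using finite_subset[OF that finite_index] that
  proof (induction J rule: finite_induct)
    case empty
    show ?case by (intro exI[of _ "{\<one>}"]) (auto simp: generate_empty)
  next
    case (insert l J)
    then have l: "J \<subseteq> I" "l \<in> I" "l \<notin> J" by auto
    let ?S = "generate G (\<Union>j\<in>J. F j)"
    interpret S: subgroup ?S G by (rule generate_factors_subgroup[OF l(1)])
    interpret A: subgroup "F l" G by (rule factor_subgroup[OF l(2)])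
    obtain T where T: "T \<subseteq> ?S" "card T = q ^ card J"
      "\<And>x y. \<lbrakk>x \<in> T; y \<in> T; inv x \<otimes> y \<in> ?M\<rbrakk> \<Longrightarrow> x = y"
      using insert.IH l(1) by auto
    let ?m = "\<lambda>(a, b). a \<otimes> b"
    \<comment> \<open>The components in \<open>F l\<close> are compared first; once they agree, they cancel, which leaves
      the separation property of \<open>T\<close>.\<close>
    have sep: "a = a' \<and> b = b'" if "a \<in> R l" "b \<in> T" "a' \<in> R l" "b' \<in> T"
        and "inv (a \<otimes> b) \<otimes> (a' \<otimes> b') \<in> ?M" for a b a' b'
    proof -
      have mem: "a \<in> F l" "a' \<in> F l" "b \<in> ?S" "b' \<in> ?S"
        using that RF l T by blast+
      then have car: "a \<in> carrier G" "a' \<in> carrier G" "b \<in> carrier G" "b' \<in> carrier G"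
        by auto
      have "inv (a \<otimes> b) \<otimes> (a' \<otimes> b') = inv b \<otimes> ((inv a \<otimes> a') \<otimes> b')"
        using car by (simp add: inv_mult_group m_assoc)
      also have "(inv a \<otimes> a') \<otimes> b' = b' \<otimes> (inv a \<otimes> a')"
        using mem by (intro factor_commutes_generate[OF l]) auto
      also have "inv b \<otimes> (b' \<otimes> (inv a \<otimes> a')) = (inv b \<otimes> b') \<otimes> (inv a \<otimes> a')"
        using car by (simp add: m_assoc)
      also have "\<dots> = (inv a \<otimes> a') \<otimes> (inv b \<otimes> b')"
        using mem by (intro factor_commutes_generate[OF l, symmetric]) auto
      finally have ab: "(inv a \<otimes> a') \<otimes> (inv b \<otimes> b') \<in> ?M"
        using that(5) by simp
      then have "inv a \<otimes> a' \<in> E l"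
        using mem by (intro component_in_subfactor[OF E EF l(2,1,3)]) auto
      then have aa: "a = a'" using Rsep that l by blast
      then have "inv b \<otimes> b' \<in> ?M" using ab car by simp
      then show ?thesis using T(3) that aa by blast
    qed
    \<comment> \<open>Equal products differ by the neutral element of \<open>?M\<close>, so \<open>sep\<close> also shows that different
      pairs have different products.\<close>
    have sep': "inv (a \<otimes> b) \<otimes> (a' \<otimes> b') \<in> ?M"
      if "a \<otimes> b = a' \<otimes> b'" "a' \<in> R l" "b' \<in> T" for a b a' b'
    proof -
      have "a' \<otimes> b' \<in> carrier G"
        using that RF[OF l(2)] T(1) A.subset S.subset by blast
      then show ?thesis using that(1) by (simp del: m_closed)
    qed
    have inj: "inj_on ?m (R l \<times> T)"
    proof (rule inj_onI)
      fix u v assume uv: "u \<in> R l \<times> T" "v \<in> R l \<times> T" "?m u = ?m v"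
      obtain a b a' b' where "u = (a, b)" "v = (a', b')" by (cases u, cases v)
      then show "u = v" using uv sep[of a b a' b'] sep'[of a b a' b'] by simp
    qed
    show ?case
    proof (intro exI[of _ "?m ` (R l \<times> T)"] conjI)
      have "R l \<subseteq> generate G (\<Union>j\<in>insert l J. F j)"
        using RF[OF l(2)] by (auto intro: generate.incl)
      moreover have "T \<subseteq> generate G (\<Union>j\<in>insert l J. F j)"
        using T(1) mono_generate[of "\<Union>j\<in>J. F j" "\<Union>j\<in>insert l J. F j"] by blast
      ultimately show "?m ` (R l \<times> T) \<subseteq> generate G (\<Union>j\<in>insert l J. F j)"
        by (auto intro: generate.eng)
      show "card (?m ` (R l \<times> T)) = q ^ card (insert l J)"
        using inj insert.hyps T(2) Rcard[OF l(2)] by (simp add: card_image card_cartesian_product)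
      show "\<forall>x\<in>?m ` (R l \<times> T). \<forall>y\<in>?m ` (R l \<times> T). inv x \<otimes> y \<in> ?M \<longrightarrow> x = y"
        using sep by auto
    qed
  qed
  then obtain T where T: "T \<subseteq> generate G (\<Union>j\<in>I. F j)" "card T = q ^ card I"
      "\<And>x y. \<lbrakk>x \<in> T; y \<in> T; inv x \<otimes> y \<in> ?M\<rbrakk> \<Longrightarrow> x = y"
    by (metis order_refl)
  have Tc: "T \<subseteq> carrier G" using T(1) generate_factors_carrier[of I] by blast
  then have "inj_on ((#>) ?M) T"
    using T(3) M.rcos_eq_iff by (intro inj_onI) blast
  moreover have "(#>) ?M ` T \<subseteq> rcosets ?M" using Tc by (auto simp: RCOSETS_def)
  ultimately show ?thesis using card_inj_on_le[OF _ _ fin] T(2) by metis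
qed

text \<open>
  The core of the argument: the order \<open>q\<close> of the image of a factor in \<open>G/N\<close> is bounded independently
  of \<open>N\<close>. The count is made modulo the product \<open>?M\<close> of the groups \<open>F j \<inter> N\<close>. The intersection of \<open>N\<close>
  with \<open>H\<close> may be larger than \<open>?M\<close>, and then \<open>H\<close> has fewer than \<open>q ^ card I\<close> cosets modulo \<open>N\<close>.
\<close>
lemma card_image_factor_le:
  assumes H: "H \<lhd> G" "H = generate G (\<Union>j\<in>I. F j)" "finite (rcosets H)"
    and perm: "\<And>g j. \<lbrakk>g \<in> carrier G; j \<in> I\<rbrakk> \<Longrightarrow> \<exists>l\<in>I. g <# F j #> inv g = F l"
    and trans: "\<And>j l. \<lbrakk>j \<in> I; l \<in> I\<rbrakk> \<Longrightarrow> \<exists>g\<in>carrier G. g <# F j #> inv g = F l"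
    and gs: "set gs \<subseteq> carrier G" "length gs < card I"
    and gen: "\<And>g. g \<in> carrier G \<Longrightarrow> \<exists>ks. length ks = length gs \<and> g = prod_of_powers G gs ks"
    and N: "N \<lhd> G" "finite (rcosets N)" and i: "i \<in> I"
  shows "card ((#>) N ` F i) \<le> card (rcosets H) ^ length gs"
proof -
  interpret H: normal H G by (rule H)
  interpret N: normal N G by (rule N)
  define q where "q = card ((#>) N ` F i)"
  let ?D = "card (rcosets H)" and ?n = "length gs"
  let ?E = "\<lambda>j. F j \<inter> N"
  let ?M = "generate G (\<Union>j\<in>I. ?E j)"
  have E: "direct_factors G I ?E"
    by (rule subfactors) (auto intro: subgroups_Inter_pair factor_subgroup N.subgroup_axioms)
  have q: "card ((#>) N ` F j) = q" if "j \<in> I" for j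
    using trans[OF i that] N.card_image_conjugate[of _ "F i"] factor_subgroup[OF i]
    by (metis q_def subgroup.subset)
  \<comment> \<open>Conjugation permutes the factors and fixes \<open>N\<close>, so it permutes the generators of \<open>?M\<close>.\<close>
  have "?M \<lhd> G"
  proof (rule normal_generateI)
    show "(\<Union>j\<in>I. ?E j) \<subseteq> carrier G" using N.subset by blast
    fix h g assume h: "h \<in> (\<Union>j\<in>I. ?E j)" and g: "g \<in> carrier G"
    then obtain j where j: "j \<in> I" "h \<in> F j" "h \<in> N" by blast
    obtain l where l: "l \<in> I" "g <# F j #> inv g = F l" using perm[OF g j(1)] by blast
    have "g \<otimes> h \<otimes> inv g \<in> F l"
      using j(2) unfolding l(2)[symmetric] by (auto simp: l_coset_def r_coset_def)
    then show "g \<otimes> h \<otimes> inv g \<in> (\<Union>j\<in>I. ?E j)"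
      using l(1) N.inv_op_closed2[OF g j(3)] by blast
  qed
  then interpret M: normal ?M G .
  have pos: "0 < ?D" "0 < q"
  proof -
    have "H \<in> rcosets H" by (rule H.subgroup_in_rcosets[OF is_group])
    then show "0 < ?D" using H(3) card_gt_0_iff by blast
    have "(#>) N ` F i \<subseteq> rcosets N" using factor_carrier[OF i] by (auto simp: RCOSETS_def)
    moreover have "F i \<noteq> {}" using subgroup.one_closed[OF factor_subgroup[OF i]] by blast
    ultimately show "0 < q" unfolding q_def using N(2) by (metis card_gt_0_iff finite_subset image_is_empty)
  qed
  \<comment> \<open>The power \<open>?D\<close> leads from \<open>G\<close> into \<open>H\<close>, and the power \<open>q\<close> from \<open>H\<close> into \<open>?M\<close>.\<close>
  have "x [^] (?D * q) \<in> ?M" if x: "x \<in> carrier G" for x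
  proof -
    have "(#>) H ` carrier G = rcosets H" by (auto simp: RCOSETS_def)
    then have "x [^] ?D \<in> H" using H.subgroup_pow_card_image[OF subgroup_self x] by simp
    then have "(x [^] ?D) [^] q \<in> ?M"
      unfolding H(2)
    proof (rule generate_factors_pow[OF E, rotated])
      fix j y assume jy: "j \<in> I" "y \<in> F j"
      then have "y [^] q \<in> N"
        using N.subgroup_pow_card_image[OF factor_subgroup] q by metis
      moreover have "y [^] q \<in> F j"
        using subgroup_int_pow_closed[OF factor_subgroup[OF jy(1)] jy(2), of "int q"]
        by (simp add: int_pow_int)
      ultimately show "y [^] q \<in> F j \<inter> N" by blast
    qed
    then show ?thesis using x by (simp add: nat_pow_pow)
  qed
  then have fin: "finite (rcosets ?M)" and le: "card (rcosets ?M) \<le> (?D * q) ^ ?n"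
    using M.rcosets_bounded_generation[OF gs(1) gen, of "?D * q"] pos by simp_all
  \<comment> \<open>In \<open>F j\<close>, cosets of \<open>F j \<inter> N\<close> correspond to cosets of \<open>N\<close>.\<close>
  have "\<exists>R. R \<subseteq> F j \<and> inj_on ((#>) N) R \<and> (#>) N ` F j = (#>) N ` R" for j
    using subset_image_inj[of "(#>) N ` F j" "(#>) N" "F j"] by auto
  then obtain R where R: "\<And>j. R j \<subseteq> F j" "\<And>j. inj_on ((#>) N) (R j)"
      "\<And>j. (#>) N ` F j = (#>) N ` R j"
    by metis
  have "q ^ card I \<le> card (rcosets ?M)"
  proof (rule card_cosets_generate_factors[OF E _ M.normal_axioms R(1) _ _ fin])
    show "card (R j) = q" if "j \<in> I" for j
      using q[OF that] R(2,3) by (metis card_image)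
    show "x = y" if "j \<in> I" "x \<in> R j" "y \<in> R j" "inv x \<otimes> y \<in> F j \<inter> N" for j x y
    proof -
      have "x \<in> carrier G" "y \<in> carrier G" using that R(1) factor_carrier by blast+
      then have "N #> x = N #> y" using that N.rcos_eq_iff by blast
      then show ?thesis using that R(2) by (meson inj_onD)
    qed
  qed auto
  moreover have "q ^ Suc ?n \<le> q ^ card I"
    using gs(2) pos(2) by (intro power_increasing) auto
  ultimately have "q * q ^ ?n \<le> ?D ^ ?n * q ^ ?n"
    using le unfolding power_mult_distrib power_Suc by linarith
  then show ?thesis using pos(2) by (simp add: q_def)
qed

end

section \<open>Branch groups\<close>

text \<open>
  Finitely many elements of \<open>K\<close> have only finitely many nontrivial quotients \<open>inv x \<otimes> y\<close>, and a single
  \<open>H m\<close> avoids all of these since the sequence decreases. So \<open>Suc B\<close> elements of \<open>K\<close> would have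
  different images modulo \<open>H m\<close>.
\<close>
lemma (in group) finite_if_bounded_images:
  assumes dec: "\<And>i. H (Suc i) \<subseteq> H i" and int: "(\<Inter>i. H i) = {\<one>}"
    and norm: "\<And>i. H i \<lhd> G" and fin: "\<And>i. finite (rcosets (H i))"
    and K: "K \<subseteq> carrier G" and bound: "\<And>i::nat. card ((#>) (H i) ` K) \<le> B"
  shows "finite K"
proof (rule ccontr)
  assume "infinite K"
  then obtain A where A: "A \<subseteq> K" "finite A" "card A = Suc B"
    using infinite_arbitrarily_large[of K "Suc B"] by auto
  let ?P = "{(x, y). x \<in> A \<and> y \<in> A \<and> x \<noteq> y}"
  have finP: "finite ?P" by (rule finite_subset[of _ "A \<times> A"]) (use A in auto)
  have "\<exists>i. inv x \<otimes> y \<notin> H i" if "(x, y) \<in> ?P" for x y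
  proof (rule ccontr)
    assume "\<nexists>i. inv x \<otimes> y \<notin> H i"
    then have "inv x \<otimes> y = \<one>" using int by blast
    moreover have "x \<in> carrier G" "y \<in> carrier G" using that A K by auto
    ultimately have "x = y" using inv_solve_left[of \<one> x y] by simp
    then show False using that by simp
  qed
  then have "\<forall>p\<in>?P. \<exists>i. inv (fst p) \<otimes> snd p \<notin> H i" by auto
  from bchoice[OF this]
  obtain i where i: "\<And>p. p \<in> ?P \<Longrightarrow> inv (fst p) \<otimes> snd p \<notin> H (i p)" by blast
  obtain m where m: "\<And>p. p \<in> ?P \<Longrightarrow> i p \<le> m"
    using finite_nat_set_iff_bounded_le[of "i ` ?P"] finP by blast
  have "inj_on ((#>) (H m)) A"
  proof (rule inj_onI, rule ccontr)
    fix x y assume xy: "x \<in> A" "y \<in> A" "H m #> x = H m #> y" "x \<noteq> y"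
    then have "inv x \<otimes> y \<in> H m"
      using normal.rcos_eq_iff[OF norm] A(1) K by blast
    moreover have P: "(x, y) \<in> ?P" using xy by simp
    moreover have "H m \<subseteq> H (i (x, y))"
      using lift_Suc_antimono_le[of H, OF dec m[OF P]] .
    ultimately show False using i[OF P] by auto
  qed
  then have "Suc B = card ((#>) (H m) ` A)" using A(3) by (simp add: card_image)
  also have "\<dots> \<le> card ((#>) (H m) ` K)"
  proof (rule card_mono)
    have "(#>) (H m) ` K \<subseteq> rcosets (H m)" using K by (auto simp: RCOSETS_def)
    then show "finite ((#>) (H m) ` K)" using fin finite_subset by blast
  qed (use A in blast)
  finally show False using bound[of m] by simp
qed

text \<open>
  Two different factors are normal in \<open>H\<close> and meet trivially, hence commute: the commutator of
  \<open>x \<in> F j\<close> and \<open>y \<in> F l\<close> lies in both factors.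
\<close>
lemma (in group) direct_factorsI:
  assumes "internal_direct_product G H I F" "finite I"
  shows "direct_factors G I F"
proof -
  have H: "subgroup H G"
    and FH: "\<And>j. j \<in> I \<Longrightarrow> F j \<lhd> G\<lparr>carrier := H\<rparr>"
    and ind: "\<And>j. j \<in> I \<Longrightarrow> F j \<inter> generate G (\<Union>l\<in>I - {j}. F l) = {\<one>}"
    using assms(1) unfolding internal_direct_product_def by simp_all
  interpret H: subgroup H G by (rule H)
  have sub: "subgroup (F j) G" if "j \<in> I" for j
    using incl_subgroup[OF H normal_imp_subgroup[OF FH[OF that]]] .
  have FinH: "x \<in> H" if "j \<in> I" "x \<in> F j" for j x
    using subgroup.subset[OF normal_imp_subgroup[OF FH[OF that(1)]]] that(2) by auto
  have conj: "g \<otimes> x \<otimes> inv g \<in> F j" if "j \<in> I" "x \<in> F j" "g \<in> H" for j x g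
    using normal.inv_op_closed2[OF FH[OF that(1)], of g x] that
    by (simp add: m_inv_consistent[OF H])
  show ?thesis
  proof (intro direct_factors.intro direct_factors_axioms.intro is_group)
    fix j l x y assume jl: "j \<in> I" "l \<in> I" "j \<noteq> l" "x \<in> F j" "y \<in> F l"
    interpret J: subgroup "F j" G by (rule sub[OF jl(1)])
    interpret L: subgroup "F l" G by (rule sub[OF jl(2)])
    have c: "x \<in> carrier G" "y \<in> carrier G" using jl by auto
    have "x \<otimes> (y \<otimes> inv x \<otimes> inv y) \<in> F j"
      using jl FinH by (intro J.m_closed conj) auto
    moreover have "(x \<otimes> y \<otimes> inv x) \<otimes> inv y \<in> F l"
      using jl FinH by (intro L.m_closed conj) auto
    then have "(x \<otimes> y \<otimes> inv x) \<otimes> inv y \<in> generate G (\<Union>l\<in>I - {j}. F l)"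
      using jl by (auto intro: generate.incl)
    ultimately have "(x \<otimes> y \<otimes> inv x) \<otimes> inv y = \<one>"
      using ind[OF jl(1)] c by (auto simp: m_assoc)
    then show "x \<otimes> y = y \<otimes> x"
      using inv_solve_right[of \<one> "x \<otimes> y \<otimes> inv x" y] inv_solve_right[of y "x \<otimes> y" x] c by simp
  qed (use assms(2) sub ind in auto)
qed

theorem theorem1:
  fixes G :: "('a, 'b) monoid_scheme"
  assumes "branch_group G"
    and "infinite (carrier G)"
  shows "\<not> boundedly_generated G"
proof
  assume "boundedly_generated G"
  then obtain gs where gs: "set gs \<subseteq> carrier G"
    and gen: "\<And>g. g \<in> carrier G \<Longrightarrow> \<exists>ks. length ks = length gs \<and> g = prod_of_powers G gs ks"
    unfolding boundedly_generated_def by blast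
  obtain H k F where "group G" and bs: "branch_structure G H k F"
    using assms(1) unfolding branch_group_def by blast
  interpret group G by fact
  have dec: "\<And>i. H (Suc i) \<subseteq> H i" and int: "(\<Inter>i. H i) = {\<one>\<^bsub>G\<^esub>}" and k0: "k 0 = 1"
    and norm: "\<And>i. H i \<lhd> G" and fin: "\<And>i. finite (rcosets\<^bsub>G\<^esub> (H i))"
    and idp: "\<And>i. internal_direct_product G (H i) {1..k i} (F i)"
    and kdvd: "\<And>i. k i dvd k (Suc i)" and kdiv: "\<And>i. 2 \<le> k (Suc i) div k i"
    and act: "\<And>i. transitive_action G (F i ` {1..k i})
           (\<lambda>g. \<lambda>K\<in>F i ` {1..k i}. g <#\<^bsub>G\<^esub> K #>\<^bsub>G\<^esub> (inv\<^bsub>G\<^esub> g))"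
    using bs unfolding branch_structure_def Let_def by auto
  have k_ge: "2 ^ i \<le> k i" for i
  proof (induction i)
    case (Suc i)
    have "2 * k i \<le> k (Suc i) div k i * k i" using kdiv by (rule mult_le_mono1)
    also have "\<dots> = k (Suc i)" using kdvd by simp
    finally show ?case using Suc by simp
  qed (simp add: k0)
  let ?n = "length gs"
  let ?I = "{1..k ?n}"
  have large: "?n < card ?I"
    using less_le_trans[OF less_exp k_ge[of ?n]] by simp
  interpret D: direct_factors G ?I "F ?n"
    using direct_factorsI[OF idp] by simp
  interpret A: transitive_action G "F ?n ` ?I"
      "\<lambda>g. \<lambda>K\<in>F ?n ` ?I. g <#\<^bsub>G\<^esub> K #>\<^bsub>G\<^esub> (inv\<^bsub>G\<^esub> g)"
    by (rule act)
  have H_gen: "H ?n = generate G (\<Union>j\<in>?I. F ?n j)"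
    using idp[of ?n] by (simp add: internal_direct_product_def)
  have perm: "\<exists>l\<in>?I. g <#\<^bsub>G\<^esub> F ?n j #>\<^bsub>G\<^esub> inv\<^bsub>G\<^esub> g = F ?n l"
    if "g \<in> carrier G" "j \<in> ?I" for g j
    using A.element_image[OF that(1) imageI[OF that(2)] refl] that(2) by auto
  have trans: "\<exists>g\<in>carrier G. g <#\<^bsub>G\<^esub> F ?n j #>\<^bsub>G\<^esub> inv\<^bsub>G\<^esub> g = F ?n l"
    if "j \<in> ?I" "l \<in> ?I" for j l
    using A.unique_orbit[of "F ?n j" "F ?n l"] that by auto
  have "finite (F ?n j)" if j: "j \<in> ?I" for j
  proof (rule finite_if_bounded_images[of H, OF dec int norm fin])
    show "F ?n j \<subseteq> carrier G" using D.factor_carrier[OF j] by blast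
    show "card ((#>\<^bsub>G\<^esub>) (H i) ` F ?n j) \<le> card (rcosets\<^bsub>G\<^esub> (H ?n)) ^ ?n" for i
      using D.card_image_factor_le[OF norm H_gen fin perm trans gs large gen norm fin j] .
  qed
  then have "finite (H ?n)"
    unfolding H_gen by (rule D.finite_generate_factors)
  then have "finite (carrier G)"
    using fin rcosets_finite rcosets_part_G normal_imp_subgroup[OF norm]
    by (metis finite_Union subgroup.subset)
  then show False using assms(2) by contradiction
qed

end
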